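(* For integers $0\leq k\leq n$, \[ (1-q)^{n-k}S_1[n,k] = \sum_{j=0}^{n-k} \sum_{i=j}^{n-k} (-1)^j\, B^{n+1,k+1}_{i,j}\, q^{i + \binom{j}2} \begin{bmatrix} i\\ j\end{bmatrix}_q . \]
   Context: $q$-binomial coefficients: $[i]_q=1+q+\dots+q^{i-1}$, $[n]_q!=[1]_q\cdots[n]_q$, $\begin{bmatrix} n\\ k\end{bmatrix}_q=\frac{[n]_q!}{[k]_q![n-k]_q!}$ for $0\leq k\leq n$, and $0$ if $k<0$ or $k>n$. For integers $N,K$ and $i,j$, \[ B^{N,K}_{i,j}=\binom{N+j-1}{K-1}\binom{N-i-1}{K-1}-\binom{N+j}{K-1}\binom{N-i-2}{K-1}, \] which also equals $\frac{i+j+1}{N+j}\binom{N+j}{K-1}\binom{N-i-2}{K-2}$; here the conventions $\binom{-2}{-2}=\binom{-1}{-1}=1$ and $\binom{u}{v}=0$ if $v<0$ and $u>v$ are used. For $n\geq 0$ let $\mathfrak{S}_n$ be the set of permutations of $\{1,\dots,n\}$. For $\sigma\in\mathfrak{S}_n$, a right-to-left maximum is an index $i$ such that $\sigma(i)>\sigma(j)$ for all $j$ with $i<j\leq n$; let $\mathrm{rlm}(\sigma)$ be their number. An inversion of $\sigma$ is a pair $(i,j)$ with $i<j$ and $\sigma(i)>\sigma(j)$; it is special if there exists $k'$ with $j<k'\leq n$ and $\sigma(i)<\sigma(k')$. Let $\mathrm{inv}'(\sigma)$ be the number of special inversions. Define $S_1[n,k]=\sum_{\sigma} q^{\mathrm{inv}'(\sigma)}$,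 summed over $\sigma\in\mathfrak{S}_n$ with $\mathrm{rlm}(\sigma)=k$. *)

theory Defs
  imports "HOL-Computational_Algebra.Polynomial" "HOL-Combinatorics.Permutations"
begin

text \<open>
  The indeterminate \<open>q\<close> is the variable of \<open>int poly\<close>.
\<close>

definition qvar :: "int poly" where
  "qvar = [:0, 1:]"

definition qint :: "nat \<Rightarrow> int poly" where
  "qint i = (\<Sum>t<i. qvar ^ t)"

definition qfact :: "nat \<Rightarrow> int poly" where
  "qfact n = (\<Prod>i=1..n. qint i)"

text \<open>
  The division is the exact one of \<open>int poly\<close>, see the lemma \<open>qbinomial_mult_qfact\<close> below.
\<close>

definition qbinomial :: "nat \<Rightarrow> nat \<Rightarrow> int poly" where
  "qbinomial n k = (if k \<le> n then qfact n div (qfact k * qfact (n - k)) else 0)"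

lemma qfact_Suc: "qfact (Suc n) = qint (Suc n) * qfact n"
  by (simp add: qfact_def mult.commute)

lemma qint_add: "qint (a + b) = qint a + qvar ^ a * qint b"
  by (induction b) (simp_all add: qint_def algebra_simps power_add)

lemma qint_nonzero:
  assumes "i > 0"
  shows "qint i \<noteq> 0"
proof
  assume "qint i = 0"
  then have "poly (qint i) 1 = 0"
    by simp
  with assms show False
    by (simp add: qint_def qvar_def poly_sum)
qed

lemma qfact_nonzero: "qfact n \<noteq> 0"
  by (auto simp: qfact_def qint_nonzero)

lemma qfact_mult_dvd_qfact_add: "qfact a * qfact b dvd qfact (a + b)"
proof (induction "a + b" arbitrary: a b)
  case 0
  then show ?case
    by (simp add: qfact_def)
next
  case (Suc n)
  show ?case
  proof (cases "a = 0 \<or> b = 0")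
    case True
    then show ?thesis
      by (auto simp: qfact_def)
  next
    case False
    then obtain c d where cd: "a = Suc c" "b = Suc d"
      by (metis not0_implies_Suc)
    from Suc(2) cd have n: "n = c + b" "n = a + d"
      by auto
    have "qfact c * qfact b dvd qfact n"
      using Suc(1)[OF n(1)] n(1) by simp
    then have 1: "qfact a * qfact b dvd qint a * qfact n"
      by (simp add: cd(1) qfact_Suc mult.assoc mult_dvd_mono)
    have "qfact a * qfact d dvd qfact n"
      using Suc(1)[OF n(2)] n(2) by simp
    then have "qint b * (qfact a * qfact d) dvd qint b * qfact n"
      by (rule mult_dvd_mono[OF dvd_refl])
    then have 2: "qfact a * qfact b dvd qvar ^ a * (qint b * qfact n)"
      unfolding cd(2) qfact_Suc by - (rule dvd_mult, simp only: mult_ac)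
    have "qfact (a + b) = qint a * qfact n + qvar ^ a * (qint b * qfact n)"
      by (simp add: Suc(2)[symmetric] qfact_Suc) (simp add: Suc(2) qint_add algebra_simps)
    with 1 2 show ?thesis
      by simp
  qed
qed

lemma qbinomial_mult_qfact:
  assumes "k \<le> n"
  shows "qbinomial n k * (qfact k * qfact (n - k)) = qfact n"
  using assms qfact_mult_dvd_qfact_add[of k "n - k"] by (simp add: qbinomial_def)

text \<open>
  Binomial coefficients with integer arguments. The value is \<open>0\<close> for \<open>u < v\<close>, also when \<open>u\<close> is
  negative: in particular \<open>ibinomial (-1) 0 = 0\<close>, unlike the polynomial convention of \<open>gchoose\<close>.
  This value is forced by the equality of the two expressions for \<open>B\<close>: for \<open>N = K = 1\<close> and
  \<open>i = j = 0\<close> the difference is \<open>1 - ibinomial (-1) 0\<close> and the product form is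
  \<open>ibinomial (-1) (-1) = 1\<close>.
\<close>

definition ibinomial :: "int \<Rightarrow> int \<Rightarrow> int" where
  "ibinomial u v =
     (if 0 \<le> v \<and> v \<le> u then int (nat u choose nat v)
      else if (u, v) \<in> {(-1, -1), (-2, -2)} then 1
      else 0)"

definition B :: "int \<Rightarrow> int \<Rightarrow> int \<Rightarrow> int \<Rightarrow> int" where
  "B N K i j =
     ibinomial (N + j - 1) (K - 1) * ibinomial (N - i - 1) (K - 1)
     - ibinomial (N + j) (K - 1) * ibinomial (N - i - 2) (K - 1)"

definition rlm :: "nat \<Rightarrow> (nat \<Rightarrow> nat) \<Rightarrow> nat" where
  "rlm n \<sigma> = card {i \<in> {1..n}. \<forall>j. i < j \<and> j \<le> n \<longrightarrow> \<sigma> i > \<sigma> j}"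

definition inversions :: "nat \<Rightarrow> (nat \<Rightarrow> nat) \<Rightarrow> (nat \<times> nat) set" where
  "inversions n \<sigma> = {(i, j). i \<in> {1..n} \<and> j \<in> {1..n} \<and> i < j \<and> \<sigma> i > \<sigma> j}"

definition special_inversions :: "nat \<Rightarrow> (nat \<Rightarrow> nat) \<Rightarrow> (nat \<times> nat) set" where
  "special_inversions n \<sigma> =
     {(i, j) \<in> inversions n \<sigma>. \<exists>k. j < k \<and> k \<le> n \<and> \<sigma> i < \<sigma> k}"

definition inv' :: "nat \<Rightarrow> (nat \<Rightarrow> nat) \<Rightarrow> nat" where
  "inv' n \<sigma> = card (special_inversions n \<sigma>)"

definition S1 :: "nat \<Rightarrow> nat \<Rightarrow> int poly" where
  "S1 n k = (\<Sum>\<sigma> | \<sigma> permutes {1..n} \<and> rlm n \<sigma> = k. qvar ^ inv' n \<sigma>)"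

end

theory Submission
  imports Defs "HOL-Computational_Algebra.Formal_Power_Series"
    "HOL-Combinatorics.Multiset_Permutations"
begin

unbundle fps_syntax

text \<open>
  Insert a letter \<open>\<infinity>\<close> into \<open>\<sigma> \<in> S\<^sub>n\<close> after \<open>c\<close> letters and let \<open>W n k c\<close> (\<open>split_S1\<close> below) be the
  generating function of the special inversions of the resulting words with \<open>k\<close> right-to-left
  maxima behind \<open>\<infinity>\<close>. Removing the largest finite letter \<open>n+1\<close>, which takes over the role of \<open>\<infinity>\<close>
  when it stands behind it, gives
  \<open>W (n+1) k c = [c] W n k (c-1) + (\<Sum>p=c..n. W n (k-1) p)\<close>.

  Let \<open>F\<^sub>c\<close> be the generating function, with \<open>z\<close> marking \<open>n\<close> and \<open>a\<close> marking \<open>k\<close>, of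
  \<open>(1-q)^(n-k) W n k c\<close>, and let \<open>Y\<close> be the power series with \<open>Y (1 + z - z a) = z Y^2 + 1\<close>. The
  recurrence becomes a three-term recurrence in \<open>c\<close>. Expanding its minimal solution in powers of
  \<open>q^c\<close> and applying Heine's transformation suggests
  \<open>F\<^sub>c = Y (z Y)^c (\<Sum>i. (q z Y)^i (Y;q)\<^sub>i (q^(i+1);q)\<^sub>c)\<close>,
  which is verified by telescoping. For \<open>c = 0\<close>, expanding \<open>(Y;q)\<^sub>i\<close> by the \<open>q\<close>-binomial theorem
  and the powers of \<open>Y\<close> by Lagrange inversion yields the formula.
\<close>

section \<open>Permutations with a marked split\<close>

primrec list_inv :: "nat list \<Rightarrow> nat" where
  "list_inv [] = 0"
| "list_inv (x # xs) = length (filter (\<lambda>y. y < x) xs) + list_inv xs"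

primrec cross_inv :: "nat \<Rightarrow> nat list \<Rightarrow> nat" where
  "cross_inv x [] = 0"
| "cross_inv x (y # ys) = (if y < x \<and> (\<exists>z\<in>set ys. x < z) then 1 else 0) + cross_inv x ys"

primrec special_inv :: "nat list \<Rightarrow> nat" where
  "special_inv [] = 0"
| "special_inv (x # xs) = cross_inv x xs + special_inv xs"

primrec list_rlm :: "nat list \<Rightarrow> nat" where
  "list_rlm [] = 0"
| "list_rlm (x # xs) = (if \<forall>y\<in>set xs. y < x then 1 else 0) + list_rlm xs"

text \<open>This counts the special inversions of \<open>us @ \<infinity> # vs\<close>.\<close>

definition split_inv :: "nat list \<Rightarrow> nat list \<Rightarrow> nat" where
  "split_inv us vs = list_inv us + (\<Sum>x\<leftarrow>us. cross_inv x vs) + special_inv vs"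

lemma cross_inv_ge: "\<forall>y\<in>set vs. y < x \<Longrightarrow> cross_inv x vs = 0"
  by (induction vs) auto

lemma cross_inv_insert_max:
  "x < m \<Longrightarrow> cross_inv x (us @ m # vs) = length (filter (\<lambda>y. y < x) us) + cross_inv x vs"
  by (induction us) auto

lemma list_inv_insert_max:
  assumes "\<forall>x\<in>set (us @ vs). x < m"
  shows "list_inv (us @ m # vs) = list_inv (us @ vs) + length vs"
  using assms by (induction us) (auto simp: filter_True)

lemma list_inv_append:
  "list_inv (us @ vs) =
    list_inv us + (\<Sum>x\<leftarrow>us. length (filter (\<lambda>y. y < x) vs)) + list_inv vs"
  by (induction us) auto

lemma special_inv_insert_max:
  assumes "\<forall>x\<in>set (us @ vs). x < m"
  shows "special_inv (us @ m # vs) = split_inv us vs"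
  using assms
  by (induction us) (auto simp: split_inv_def cross_inv_insert_max cross_inv_ge)

lemma list_rlm_insert_max:
  assumes "\<forall>x\<in>set (us @ vs). x < m"
  shows "list_rlm (us @ m # vs) = Suc (list_rlm vs)"
  using assms by (induction us) (auto dest: order.asym)

text \<open>The inversions of \<open>m\<close> with the letters of \<open>us'\<close> are special
  because \<infinity> follows them. Those with letters of \<open>vs\<close> are not, as nothing
  behind \<infinity> exceeds \<open>m\<close>.\<close>

lemma split_inv_insert_max_left:
  assumes "\<forall>x\<in>set (us @ us' @ vs). x < m"
  shows "split_inv (us @ m # us') vs = split_inv (us @ us') vs + length us'"
  using assms list_inv_insert_max[of us us' m] by (simp add: split_inv_def ball_Un cross_inv_ge)

text \<open>Every inversion among the finite letters in front of \<open>m\<close> becomes special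
  through \<open>m\<close>, which therefore replaces \<infinity>. It starts no special inversion
  itself.\<close>

lemma split_inv_insert_max_right:
  assumes "\<forall>x\<in>set (us @ vs @ vs'). x < m"
  shows "split_inv us (vs @ m # vs') = split_inv (us @ vs) vs'"
proof -
  have "(\<Sum>x\<leftarrow>us. cross_inv x (vs @ m # vs')) =
      (\<Sum>x\<leftarrow>us. length (filter (\<lambda>y. y < x) vs)) + (\<Sum>x\<leftarrow>us. cross_inv x vs')"
    unfolding sum_list_addf[symmetric] using assms
    by (intro arg_cong[where f = sum_list] map_cong) (auto simp: cross_inv_insert_max)
  then show ?thesis
    using assms special_inv_insert_max[of vs vs' m]
    by (simp add: split_inv_def list_inv_append)
qed

lemma split_inv_Nil: "split_inv [] vs = special_inv vs"
  by (simp add: split_inv_def)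

lemma list_rlm_le: "list_rlm xs \<le> length xs"
  by (induction xs) auto

section \<open>Insertion of the largest letter and the resulting recurrence\<close>

definition insert_at :: "nat \<Rightarrow> 'a \<Rightarrow> 'a list \<Rightarrow> 'a list" where
  "insert_at p m xs = take p xs @ m # drop p xs"

text \<open>Injectivity suffices, since both sides have \<open>(n+1)!\<close> elements.\<close>

lemma bij_betw_insert_max:
  "bij_betw (\<lambda>(p, xs). insert_at p (Suc n) xs)
    ({..n} \<times> permutations_of_set {1..n}) (permutations_of_set {1..Suc n})"
proof -
  have "p = p' \<and> xs = xs'"
    if xs: "xs \<in> permutations_of_set {1..n}" "xs' \<in> permutations_of_set {1..n}"
      and p: "p \<le> n" "p' \<le> n"
      and eq: "insert_at p (Suc n) xs = insert_at p' (Suc n) xs'" for p p' xs xs'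
  proof -
    have "Suc n \<notin> set (take p xs) \<union> set (drop p xs)"
      using xs by (auto dest!: in_set_takeD in_set_dropD permutations_of_setD(1))
    then have "take p xs = take p' xs' \<and> drop p xs = drop p' xs'"
      using eq unfolding insert_at_def
      by (subst (asm) append_Cons_eq_iff) simp_all
    moreover have "length xs = n" "length xs' = n"
      using xs by (simp_all add: length_finite_permutations_of_set)
    ultimately show ?thesis
      using p by (metis append_take_drop_id length_take min.absorb2)
  qed
  note unique = this
  have "inj_on (\<lambda>(p, xs). insert_at p (Suc n) xs) ({..n} \<times> permutations_of_set {1..n})"
  proof (rule inj_onI)
    fix u v
    assume "u \<in> {..n} \<times> permutations_of_set {1..n}" "v \<in> {..n} \<times> permutations_of_set {1..n}"
      "(\<lambda>(p, xs). insert_at p (Suc n) xs) u = (\<lambda>(p, xs). insert_at p (Suc n) xs) v"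
    then show "u = v"
      using unique[of "snd u" "snd v" "fst u" "fst v"] by (auto simp: case_prod_unfold prod_eq_iff)
  qed
  moreover have "(\<lambda>(p, xs). insert_at p (Suc n) xs) ` ({..n} \<times> permutations_of_set {1..n})
      \<subseteq> permutations_of_set {1..Suc n}"
  proof clarify
    fix p xs assume "xs \<in> permutations_of_set {1..n}"
    then have xs: "set xs = {1..n}" "distinct xs"
      by (auto dest: permutations_of_setD)
    have "set (insert_at p (Suc n) xs) = insert (Suc n) (set (take p xs @ drop p xs))"
      unfolding insert_at_def by (simp del: append_take_drop_id)
    moreover have "distinct (insert_at p (Suc n) xs) \<longleftrightarrow>
        Suc n \<notin> set (take p xs @ drop p xs) \<and> distinct (take p xs @ drop p xs)"
      unfolding insert_at_def by (auto simp del: append_take_drop_id)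
    ultimately show "insert_at p (Suc n) xs \<in> permutations_of_set {1..Suc n}"
      using xs by (intro permutations_of_setI) auto
  qed
  moreover have "card ({..n} \<times> permutations_of_set {1..n}) = card (permutations_of_set {1..Suc n})"
    by (simp only: card_cartesian_product card_permutations_of_set finite_atLeastAtMost) simp
  ultimately show ?thesis
    unfolding bij_betw_def by (metis card_image card_subset_eq finite_permutations_of_set)
qed

definition split_S1 :: "nat \<Rightarrow> nat \<Rightarrow> nat \<Rightarrow> int poly" where
  "split_S1 n k c = (\<Sum>xs \<in> permutations_of_set {1..n}.
     if list_rlm (drop c xs) = k then qvar ^ split_inv (take c xs) (drop c xs) else 0)"

lemma split_S1_0: "split_S1 0 k 0 = (if k = 0 then 1 else 0)"
  by (simp add: split_S1_def split_inv_def)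

text \<open>Covers the range where the exponent \<open>n - k\<close> of \<open>1 - q\<close>
  truncates.\<close>

lemma split_S1_eq_0: "n < k \<Longrightarrow> split_S1 n k c = 0"
  unfolding split_S1_def
proof (intro sum.neutral ballI)
  fix xs assume "n < k" "xs \<in> permutations_of_set {1..n}"
  then have "list_rlm (drop c xs) < k"
    using list_rlm_le[of "drop c xs"] by (simp add: length_finite_permutations_of_set)
  then show "(if list_rlm (drop c xs) = k then qvar ^ split_inv (take c xs) (drop c xs) else 0) = 0"
    by simp
qed

text \<open>Here \<open>p\<close> is the position at which the largest letter enters the finite
  word; \<open>p < c\<close> puts it in front of \<infinity>. For \<open>c = 0\<close> the truncated
  \<open>c - 1\<close> is harmless because \<open>qint 0 = 0\<close>.\<close>

lemma split_S1_Suc: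
  assumes "c \<le> Suc n"
  shows "split_S1 (Suc n) k c = qint c * split_S1 n k (c - 1)
    + (if k = 0 then 0 else \<Sum>p=c..n. split_S1 n (k - 1) p)"
proof -
  define w where "w c k xs = (if list_rlm (drop c xs) = k
    then qvar ^ split_inv (take c xs) (drop c xs) else 0)" for c k and xs :: "nat list"
  have S1: "split_S1 n k c = (\<Sum>xs \<in> permutations_of_set {1..n}. w c k xs)" for n k c
    by (simp add: split_S1_def w_def)
  \<comment> \<open>Each of the \<open>c - 1 - p\<close> letters between the new maximum and
    \<infinity> forms a special inversion with it. Over all \<open>p < c\<close> these powers of
    \<open>q\<close> add up to \<open>qint c\<close>.\<close>
  have left: "w c k (insert_at p (Suc n) xs) = qvar ^ (c - 1 - p) * w (c - 1) k xs"
    if "xs \<in> permutations_of_set {1..n}" "p < c" for p xs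
  proof -
    have lt: "\<forall>x\<in>set xs. x < Suc n"
      using that by (auto dest: permutations_of_setD(1))
    have len: "length xs = n"
      using that by (simp add: length_finite_permutations_of_set)
    obtain d where d: "c = Suc (p + d)"
      using \<open>p < c\<close> less_iff_Suc_add by auto
    have p: "p + d \<le> n"
      using d assms by simp
    have "take c (insert_at p (Suc n) xs) = take p xs @ Suc n # take d (drop p xs)"
      "drop c (insert_at p (Suc n) xs) = drop (c - 1) xs"
      using p len by (simp_all add: insert_at_def d min_def add.commute)
    moreover have "take (c - 1) xs = take p xs @ take d (drop p xs)"
      by (simp add: d take_add)
    moreover have "split_inv (take p xs @ Suc n # take d (drop p xs)) (drop (c - 1) xs)
        = split_inv (take p xs @ take d (drop p xs)) (drop (c - 1) xs) + d"
      using lt p len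
      by (subst split_inv_insert_max_left) (auto dest!: in_set_takeD in_set_dropD)
    ultimately show ?thesis
      by (simp add: w_def d power_add)
  qed
  \<comment> \<open>Behind \<infinity> the new maximum is a right-to-left maximum and hides those
    between it and \<infinity>. The other \<open>k - 1\<close> lie behind position \<open>p\<close>,
    and \<open>k = 0\<close> cannot occur.\<close>
  have right: "w c k (insert_at p (Suc n) xs) = (if k = 0 then 0 else w p (k - 1) xs)"
    if "xs \<in> permutations_of_set {1..n}" "c \<le> p" "p \<le> n" for p xs
  proof -
    have lt: "\<forall>x\<in>set xs. x < Suc n"
      using that by (auto dest: permutations_of_setD(1))
    have len: "length xs = n"
      using that by (simp add: length_finite_permutations_of_set)
    obtain d where d: "p = c + d"
      using \<open>c \<le> p\<close> le_Suc_ex by auto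
    have "take c (insert_at p (Suc n) xs) = take c xs"
      "drop c (insert_at p (Suc n) xs) = take d (drop c xs) @ Suc n # drop p xs"
      using that len by (simp_all add: insert_at_def d take_drop add.commute)
    moreover have "take p xs = take c xs @ take d (drop c xs)"
      by (simp add: d take_add)
    moreover have "split_inv (take c xs) (take d (drop c xs) @ Suc n # drop p xs)
        = split_inv (take c xs @ take d (drop c xs)) (drop p xs)"
      using lt by (subst split_inv_insert_max_right) (auto dest!: in_set_takeD in_set_dropD)
    moreover have "list_rlm (take d (drop c xs) @ Suc n # drop p xs) = Suc (list_rlm (drop p xs))"
      using lt by (subst list_rlm_insert_max) (auto dest!: in_set_takeD in_set_dropD)
    ultimately show ?thesis
      by (auto simp: w_def)
  qed
  have "split_S1 (Suc n) k c =
      (\<Sum>(p, xs)\<in>{..n} \<times> permutations_of_set {1..n}. w c k (insert_at p (Suc n) xs))"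
    unfolding S1 by (subst sum.reindex_bij_betw[OF bij_betw_insert_max, symmetric])
      (simp add: case_prod_unfold)
  also have "\<dots> = (\<Sum>p\<le>n. \<Sum>xs\<in>permutations_of_set {1..n}. w c k (insert_at p (Suc n) xs))"
    by (simp add: sum.cartesian_product)
  also have "{..n} = {..<c} \<union> {c..n}"
    using assms by auto
  also have "(\<Sum>p\<in>{..<c} \<union> {c..n}. \<Sum>xs\<in>permutations_of_set {1..n}. w c k (insert_at p (Suc n) xs))
      = (\<Sum>p<c. \<Sum>xs\<in>permutations_of_set {1..n}. w c k (insert_at p (Suc n) xs))
      + (\<Sum>p=c..n. \<Sum>xs\<in>permutations_of_set {1..n}. w c k (insert_at p (Suc n) xs))"
    by (rule sum.union_disjoint) auto
  also have "(\<Sum>p<c. \<Sum>xs\<in>permutations_of_set {1..n}. w c k (insert_at p (Suc n) xs))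
      = (\<Sum>p<c. qvar ^ (c - 1 - p) * split_S1 n k (c - 1))"
    unfolding S1 sum_distrib_left by (intro sum.cong refl left) auto
  also have "\<dots> = (\<Sum>p<c. qvar ^ (c - 1 - p)) * split_S1 n k (c - 1)"
    by (simp add: sum_distrib_right)
  also have "(\<Sum>p<c. qvar ^ (c - 1 - p)) = qint c"
    unfolding qint_def using sum.nat_diff_reindex[of "\<lambda>p. qvar ^ p" c] by simp
  also have "(\<Sum>p=c..n. \<Sum>xs\<in>permutations_of_set {1..n}. w c k (insert_at p (Suc n) xs))
      = (\<Sum>p=c..n. \<Sum>xs\<in>permutations_of_set {1..n}. if k = 0 then 0 else w p (k - 1) xs)"
    by (intro sum.cong refl right) auto
  also have "\<dots> = (if k = 0 then 0 else \<Sum>p=c..n. split_S1 n (k - 1) p)"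
    by (simp add: S1)
  finally show ?thesis .
qed

section \<open>Translation from positions of a permutation to words\<close>

lemma Collect_less_Suc_split:
  "{i. i < Suc n \<and> P i} = (if P 0 then {0} else {}) \<union> Suc ` {i. i < n \<and> P (Suc i)}"
  by (auto simp: image_iff less_Suc_eq_0_disj)

lemma card_less_Suc_split:
  "card {i. i < Suc n \<and> P i} = (if P 0 then 1 else 0) + card {i. i < n \<and> P (Suc i)}"
  unfolding Collect_less_Suc_split
  by (subst card_Un_disjoint) (auto simp: card_image)

lemma list_rlm_conv_card:
  "list_rlm xs = card {i. i < length xs \<and> (\<forall>j. i < j \<and> j < length xs \<longrightarrow> xs ! j < xs ! i)}"
proof (induction xs)
  case (Cons x xs)
  have "(\<forall>y\<in>set xs. y < x) \<longleftrightarrow> (\<forall>j. 0 < j \<and> j < Suc (length xs) \<longrightarrow> (x # xs) ! j < x)"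
    by (auto simp: all_set_conv_all_nth nth_Cons split: nat.splits)
  moreover have "(\<forall>j. Suc i < j \<and> j < Suc (length xs) \<longrightarrow> (x # xs) ! j < xs ! i) \<longleftrightarrow>
      (\<forall>j. i < j \<and> j < length xs \<longrightarrow> xs ! j < xs ! i)" for i
    by (auto simp: nth_Cons split: nat.splits)
  ultimately show ?case
    by (simp add: card_less_Suc_split Cons)
qed simp

lemma cross_inv_conv_card:
  "cross_inv x ys = card {j. j < length ys \<and> ys ! j < x \<and>
     (\<exists>l. j < l \<and> l < length ys \<and> x < ys ! l)}"
proof (induction ys)
  case (Cons y ys)
  have "(\<exists>z\<in>set ys. x < z) \<longleftrightarrow> (\<exists>l. 0 < l \<and> l < Suc (length ys) \<and> x < (y # ys) ! l)"
  proof
    assume "\<exists>z\<in>set ys. x < z"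
    then obtain l where "l < length ys" "x < ys ! l"
      by (auto simp: in_set_conv_nth)
    then show "\<exists>l. 0 < l \<and> l < Suc (length ys) \<and> x < (y # ys) ! l"
      by (intro exI[of _ "Suc l"]) simp
  qed (auto simp: gr0_conv_Suc)
  moreover have "(\<exists>l. Suc j < l \<and> l < Suc (length ys) \<and> x < (y # ys) ! l) \<longleftrightarrow>
      (\<exists>l. j < l \<and> l < length ys \<and> x < ys ! l)" for j
  proof
    assume "\<exists>l. Suc j < l \<and> l < Suc (length ys) \<and> x < (y # ys) ! l"
    then obtain l where "Suc j < l" "l < Suc (length ys)" "x < (y # ys) ! l"
      by blast
    then show "\<exists>l. j < l \<and> l < length ys \<and> x < ys ! l"
      by (cases l) auto
  next
    assume "\<exists>l. j < l \<and> l < length ys \<and> x < ys ! l"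
    then obtain l where "j < l" "l < length ys" "x < ys ! l"
      by blast
    then show "\<exists>l. Suc j < l \<and> l < Suc (length ys) \<and> x < (y # ys) ! l"
      by (intro exI[of _ "Suc l"]) simp
  qed
  ultimately show ?case
    by (simp add: card_less_Suc_split Cons)
qed simp

lemma special_inv_conv_sum:
  "special_inv xs = (\<Sum>i<length xs. cross_inv (xs ! i) (drop (Suc i) xs))"
  by (induction xs) (simp_all add: sum.lessThan_Suc_shift del: sum.lessThan_Suc)

lemma rlm_conv_list_rlm: "rlm n \<sigma> = list_rlm (map \<sigma> [1..<Suc n])"
proof -
  have "{i \<in> {1..n}. \<forall>j. i < j \<and> j \<le> n \<longrightarrow> \<sigma> i > \<sigma> j} =
      Suc ` {i. i < n \<and> (\<forall>j. i < j \<and> j < n \<longrightarrow> \<sigma> (Suc j) < \<sigma> (Suc i))}"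
    (is "?L = Suc ` ?R")
  proof
    show "?L \<subseteq> Suc ` ?R"
    proof
      fix i assume "i \<in> ?L"
      then obtain l where "i = Suc l" "l \<in> ?R"
        by (cases i) auto
      then show "i \<in> Suc ` ?R" by blast
    qed
    show "Suc ` ?R \<subseteq> ?L"
    proof clarify
      fix i assume i: "i < n" "\<forall>j. i < j \<and> j < n \<longrightarrow> \<sigma> (Suc j) < \<sigma> (Suc i)"
      have "\<sigma> j < \<sigma> (Suc i)" if "Suc i < j" "j \<le> n" for j
        using i(2)[rule_format, of "j - 1"] that by (cases j) auto
      then show "Suc i \<in> {1..n} \<and> (\<forall>j. Suc i < j \<and> j \<le> n \<longrightarrow> \<sigma> j < \<sigma> (Suc i))"
        using i(1) by simp
    qed
  qed
  then show ?thesis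
    by (simp add: rlm_def list_rlm_conv_card card_image del: upt_Suc cong: conj_cong)
qed

lemma inv'_conv_special_inv: "inv' n \<sigma> = special_inv (map \<sigma> [1..<Suc n])"
proof -
  \<comment> \<open>\<open>i\<close> is a position counted from 0 and \<open>j\<close> an offset in
    the tail behind it, so the pair encodes the positions \<open>i + 1\<close> and
    \<open>i + j + 2\<close> of \<sigma>.\<close>
  define J where "J i = {j. j < n - Suc i \<and> \<sigma> (Suc (Suc i + j)) < \<sigma> (Suc i) \<and>
      (\<exists>l. j < l \<and> l < n - Suc i \<and> \<sigma> (Suc i) < \<sigma> (Suc (Suc i + l)))}" for i
  have "special_inversions n \<sigma> = (\<lambda>(i, j). (Suc i, Suc (Suc i + j))) ` (SIGMA i:{..<n}. J i)"
    (is "?L = ?f ` ?R")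
  proof
    show "?L \<subseteq> ?f ` ?R"
    proof clarify
      fix i j assume "(i, j) \<in> ?L"
      then obtain k where ij: "1 \<le> i" "i < j" "j \<le> n" "\<sigma> j < \<sigma> i" "j < k" "k \<le> n" "\<sigma> i < \<sigma> k"
        by (auto simp: special_inversions_def inversions_def)
      define i' j' l where "i' = i - 1" and "j' = j - i - 1" and "l = k - i - 1"
      have "(i', j') \<in> ?R"
        using ij by (auto simp: J_def i'_def j'_def l_def intro!: exI[of _ l])
      moreover have "?f (i', j') = (i, j)"
        using ij by (auto simp: i'_def j'_def)
      ultimately show "(i, j) \<in> ?f ` ?R"
        by (intro image_eqI[of _ _ "(i', j')"]) (simp_all only:)
    qed
    show "?f ` ?R \<subseteq> ?L"
    proof clarify
      fix i j assume "i < n" "j \<in> J i"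
      then obtain l where "j < n - Suc i" "\<sigma> (Suc (Suc i + j)) < \<sigma> (Suc i)"
        "j < l" "l < n - Suc i" "\<sigma> (Suc i) < \<sigma> (Suc (Suc i + l))"
        by (auto simp: J_def)
      then show "(Suc i, Suc (Suc i + j)) \<in> special_inversions n \<sigma>"
        unfolding special_inversions_def inversions_def
        by (auto intro!: exI[of _ "Suc (Suc i + l)"])
    qed
  qed
  moreover have "inj_on ?f ?R"
    by (auto simp: inj_on_def)
  ultimately have "inv' n \<sigma> = card ?R"
    by (simp add: inv'_def card_image)
  also have "\<dots> = (\<Sum>i<n. card (J i))"
    by (subst card_SigmaI) (auto simp: J_def)
  also have "\<dots> = special_inv (map \<sigma> [1..<Suc n])"
    unfolding special_inv_conv_sum
    by (rule sum.cong) (simp_all add: cross_inv_conv_card J_def del: upt_Suc cong: conj_cong)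
  finally show ?thesis .
qed

lemma bij_betw_permutes_lists:
  "bij_betw (\<lambda>\<sigma>. map \<sigma> [1..<Suc n]) {\<sigma>. \<sigma> permutes {1..n}} (permutations_of_set {1..n})"
proof -
  let ?f = "\<lambda>\<sigma>. map \<sigma> [1..<Suc n]"
  have set: "set [1..<Suc n] = {1..n}"
    by auto
  have "inj_on ?f {\<sigma>. \<sigma> permutes {1..n}}"
  proof (rule inj_onI, clarify)
    fix \<sigma> \<tau> assume p: "\<sigma> permutes {1..n}" "\<tau> permutes {1..n}" and "?f \<sigma> = ?f \<tau>"
    then have "\<forall>i\<in>{1..n}. \<sigma> i = \<tau> i"
      unfolding map_eq_conv set by blast
    with p show "\<sigma> = \<tau>"
      by (metis ext permutes_not_in)
  qed
  moreover have "?f ` {\<sigma>. \<sigma> permutes {1..n}} \<subseteq> permutations_of_set {1..n}"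
  proof clarify
    fix \<sigma> assume p: "\<sigma> permutes {1..n}"
    show "?f \<sigma> \<in> permutations_of_set {1..n}"
      by (rule permutations_of_setI)
        (simp_all only: set_map set permutes_image[OF p] distinct_map distinct_upt
          permutes_inj_on[OF p] simp_thms)
  qed
  ultimately show ?thesis
    unfolding bij_betw_def
    by (intro conjI card_subset_eq) (simp_all add: card_image card_permutations)
qed

text \<open>For \<open>c = 0\<close> the letter \<infinity> stands first: it starts no special
  inversion, and all right-to-left maxima of the word lie behind it.\<close>

lemma S1_conv_split_S1: "S1 n k = split_S1 n k 0"
proof -
  have "S1 n k = (\<Sum>\<sigma> | \<sigma> permutes {1..n}.
      if list_rlm (map \<sigma> [1..<Suc n]) = k then qvar ^ special_inv (map \<sigma> [1..<Suc n]) else 0)"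
    unfolding S1_def
    by (intro sum.mono_neutral_cong_left)
      (auto simp: finite_permutations rlm_conv_list_rlm inv'_conv_special_inv)
  also have "\<dots> = split_S1 n k 0"
    unfolding split_S1_def
    by (subst sum.reindex_bij_betw[OF bij_betw_permutes_lists, symmetric])
      (simp only: split_inv_Nil drop_0 take_0)
  finally show ?thesis .
qed

section \<open>A telescoping solution of the recurrence\<close>

text \<open>
  \<open>Y p\<close> stands for the power \<open>Y^p\<close>, about which only a linear relation is used, so \<open>qpoch_mult q Y i p\<close>
  is \<open>(Y;q)\<^sub>i Y^p\<close>, and \<open>height_series q z Y M c\<close> is \<open>F\<^sub>c\<close> truncated to \<open>i < M\<close>.
\<close>

primrec qpoch_mult :: "'a::comm_ring_1 \<Rightarrow> (nat \<Rightarrow> 'a) \<Rightarrow> nat \<Rightarrow> nat \<Rightarrow> 'a" where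
  "qpoch_mult q Y 0 p = Y p"
| "qpoch_mult q Y (Suc i) p = qpoch_mult q Y i p - q ^ i * qpoch_mult q Y i (Suc p)"

definition qpoch :: "'a::comm_ring_1 \<Rightarrow> nat \<Rightarrow> nat \<Rightarrow> 'a" where
  "qpoch q c i = (\<Prod>l<c. 1 - q ^ (i + 1 + l))"

definition height_series ::
    "'a::comm_ring_1 \<Rightarrow> 'a \<Rightarrow> (nat \<Rightarrow> 'a) \<Rightarrow> nat \<Rightarrow> nat \<Rightarrow> 'a" where
  "height_series q z Y M c =
     (\<Sum>i<M. q ^ i * qpoch q c i * z ^ (c + i) * qpoch_mult q Y i (Suc (c + i)))"

lemma qpoch_Suc: "qpoch q (Suc c) i = qpoch q c i * (1 - q ^ (i + 1 + c))"
  by (simp add: qpoch_def)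

text \<open>Splitting off the first factor instead of the last trades a step in \<open>c\<close> for
  a step in \<open>i\<close>, as the telescoping requires.\<close>

lemma qpoch_Suc_shift: "qpoch q (Suc c) i = (1 - q ^ Suc i) * qpoch q c (Suc i)"
  unfolding qpoch_def by (subst prod.lessThan_Suc_shift) simp

text \<open>\<open>qpoch_mult q Y i p\<close> is a linear combination of shifts
  \<open>Y (p + j)\<close> with coefficients independent of \<open>p\<close>, so the relation is
  inherited.\<close>

lemma qpoch_mult_kernel:
  fixes q z a :: "'a::comm_ring_1"
  assumes "\<And>p. Y (Suc p) * (1 + z - z * a) = z * Y (Suc (Suc p)) + Y p"
  shows "qpoch_mult q Y i (Suc p) * (1 + z - z * a)
    = z * qpoch_mult q Y i (Suc (Suc p)) + qpoch_mult q Y i p"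
proof (induction i arbitrary: p)
  case (Suc i)
  show ?case
    unfolding qpoch_mult.simps left_diff_distrib mult.assoc Suc by (simp add: algebra_simps)
qed (simp add: assms)

text \<open>This is the difference of the recurrences for \<open>c + 1\<close> and
  \<open>c + 2\<close>, which removes the sum over \<open>p\<close>. The last term is the error of
  truncation at \<open>M\<close>.\<close>

lemma height_series_rec_Suc:
  fixes q z a :: "'a::comm_ring_1" and M :: nat
  assumes "\<And>p. Y (Suc p) * (1 + z - z * a) = z * Y (Suc (Suc p)) + Y p"
  defines "F \<equiv> height_series q z Y M"
  shows "F (Suc c) - F (Suc (Suc c)) =
    z * (1 - q ^ Suc c) * F c - z * (1 - q ^ Suc (Suc c)) * F (Suc c) + z * a * F (Suc c)
      - z ^ (Suc c + M) * (q ^ (Suc c + M) * (1 - q ^ M) * qpoch q c M * qpoch_mult q Y M (Suc c + M))"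
proof -
  \<comment> \<open>The telescoping certificate: its factor \<open>1 - q ^ i\<close> makes
    \<open>A 0\<close> vanish, and \<open>A M\<close> is the truncation error.\<close>
  define A where "A i = z ^ (Suc c + i) *
      (q ^ (Suc c + i) * (1 - q ^ i) * qpoch q c i * qpoch_mult q Y i (Suc c + i))" for i
  define g where "g d i = q ^ i * qpoch q d i * z ^ (d + i) * qpoch_mult q Y i (Suc (d + i))" for d i
  have F: "F d = (\<Sum>i<M. g d i)" for d
    by (simp add: F_def height_series_def g_def)
  have step: "g (Suc c) i * (1 + z - z * a) - z * q ^ Suc (Suc c) * g (Suc c) i
      - g (Suc (Suc c)) i - z * (1 - q ^ Suc c) * g c i = A i - A (Suc i)" for i
  proof -
    define t where "t r = qpoch_mult q Y i (r + (c + i))" for r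
    have ts: "qpoch_mult q Y i (Suc (c + i)) = t 1" "qpoch_mult q Y i (Suc (Suc (c + i))) = t 2"
      "qpoch_mult q Y i (Suc (Suc (Suc (c + i)))) = t 3"
      by (simp_all add: t_def numeral_eq_Suc)
    have K: "t 2 * (1 + z - z * a) = z * t 3 + t 1"
      using qpoch_mult_kernel[where Y = Y and z = z and a = a and q = q and i = i, OF assms(1), of "Suc (c + i)"] by (simp add: ts)
    \<comment> \<open>Eliminating the lowest power \<open>t 1\<close> leaves an identity between
      multiples of \<open>t 2\<close> and \<open>t 3\<close>.\<close>
    then have K': "t (Suc 0) = t 2 * (1 + z - z * a) - z * t 3"
      by (simp add: ts)
    have P1: "qpoch q (Suc c) i = qpoch q c i * (1 - q * q ^ c * q ^ i)"
      by (simp add: qpoch_Suc power_add mult_ac)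
    have P2: "qpoch q (Suc (Suc c)) i = qpoch q (Suc c) i * (1 - q * q * q ^ c * q ^ i)"
      by (simp add: qpoch_Suc[of q "Suc c"] power_add mult_ac)
    have P3: "(1 - q * q ^ i) * qpoch q c (Suc i) = qpoch q (Suc c) i"
      by (simp add: qpoch_Suc_shift)
    have AS: "A (Suc i) = z ^ (Suc c + i) * z * (q ^ (Suc c + i) * q * qpoch q (Suc c) i * (t 2 - q ^ i * t 3))"
      unfolding A_def P3[symmetric] by (simp add: ts mult_ac)
    show ?thesis
      unfolding AS unfolding g_def A_def
      unfolding K' P2 P1 ts add_Suc add_Suc_right power_add power_Suc by (simp add: K' algebra_simps)
  qed
  have "(\<Sum>i<M. g (Suc c) i * (1 + z - z * a) - z * q ^ Suc (Suc c) * g (Suc c) i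
      - g (Suc (Suc c)) i - z * (1 - q ^ Suc c) * g c i) = A 0 - A M"
    unfolding step by (rule sum_lessThan_telescope')
  then have "F (Suc c) * (1 + z - z * a) - z * q ^ Suc (Suc c) * F (Suc c)
      - F (Suc (Suc c)) - z * (1 - q ^ Suc c) * F c = - A M"
    unfolding F by (simp add: A_def sum_subtractf sum_distrib_left sum_distrib_right)
  then show ?thesis
    unfolding A_def by (simp add: algebra_simps)
qed

text \<open>At the boundary there is no term from \<open>c - 1\<close>; instead
  \<open>A 0 = Y 0\<close> supplies the initial value.\<close>

lemma height_series_rec_0:
  fixes q z a :: "'a::comm_ring_1" and M :: nat
  assumes "\<And>p. Y (Suc p) * (1 + z - z * a) = z * Y (Suc (Suc p)) + Y p"
  defines "F \<equiv> height_series q z Y M"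
  shows "F 0 - F 1 = Y 0 - z * (1 - q) * F 0 + z * a * F 0 - z ^ M * (q ^ M * qpoch_mult q Y M M)"
proof -
  define A where "A i = z ^ i * (q ^ i * qpoch_mult q Y i i)" for i
  define g where "g d i = q ^ i * qpoch q d i * z ^ (d + i) * qpoch_mult q Y i (Suc (d + i))" for d i
  have F: "F d = (\<Sum>i<M. g d i)" for d
    by (simp add: F_def height_series_def g_def)
  have step: "g 0 i * (1 + z - z * a) - z * q * g 0 i - g 1 i = A i - A (Suc i)" for i
  proof -
    have K: "qpoch_mult q Y i i = qpoch_mult q Y i (Suc i) * (1 + z - z * a) - z * qpoch_mult q Y i (Suc (Suc i))"
      using qpoch_mult_kernel[where Y = Y and z = z and a = a and q = q and i = i, OF assms(1), of i] by simp
    show ?thesis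
      unfolding g_def A_def One_nat_def qpoch_Suc qpoch_mult.simps K
      by (simp add: qpoch_def algebra_simps)
  qed
  have "(\<Sum>i<M. g 0 i * (1 + z - z * a) - z * q * g 0 i - g 1 i) = A 0 - A M"
    unfolding step by (rule sum_lessThan_telescope')
  then have "F 0 * (1 + z - z * a) - z * q * F 0 - F 1 = Y 0 - A M"
    unfolding F by (simp add: A_def sum_subtractf sum_distrib_left sum_distrib_right)
  then show ?thesis
    unfolding A_def by (simp add: algebra_simps)
qed

section \<open>Comparison of coefficients\<close>

lemma qbinomial_0: "qbinomial i 0 = 1"
  using qbinomial_mult_qfact[of 0 i] qfact_nonzero[of i] by (simp add: qfact_def)

text \<open>After multiplication by \<open>qfact (Suc j) * qfact r\<close> with
  \<open>r = i - j\<close>, this q-Pascal rule reduces to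
  \<open>qint (r + Suc j) = qint r + qvar ^ r * qint (Suc j)\<close>.\<close>

lemma qbinomial_Suc_Suc:
  assumes "j \<le> i"
  shows "qbinomial (Suc i) (Suc j) = qbinomial i (Suc j) + qvar ^ (i - j) * qbinomial i j"
proof -
  obtain r where i: "i = j + r"
    using assms le_Suc_ex by blast
  have 1: "qbinomial i (Suc j) * (qfact (Suc j) * qfact r) = qint r * qfact i"
  proof (cases r)
    case 0
    then show ?thesis
      by (simp add: qbinomial_def qint_def i)
  next
    case (Suc r')
    have "qbinomial i (Suc j) * (qfact (Suc j) * qfact r') = qfact i"
      using qbinomial_mult_qfact[of "Suc j" i] by (simp add: i Suc)
    then show ?thesis
      by (simp add: Suc qfact_Suc[of r'] mult_ac)
  qed
  have 2: "qbinomial i j * (qfact (Suc j) * qfact r) = qint (Suc j) * qfact i"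
    using qbinomial_mult_qfact[of j i] by (simp add: i qfact_Suc mult_ac)
  have "qbinomial (Suc i) (Suc j) * (qfact (Suc j) * qfact r) = qint (r + Suc j) * qfact i"
    using qbinomial_mult_qfact[of "Suc j" "Suc i"] by (simp add: i qfact_Suc[of "j + r"] add.commute)
  also have "\<dots> = (qbinomial i (Suc j) + qvar ^ r * qbinomial i j) * (qfact (Suc j) * qfact r)"
    unfolding qint_add distrib_right mult.assoc 1 2 ..
  finally show ?thesis
    by (simp add: qfact_nonzero i)
qed

text \<open>
  The coefficient of \<open>z^m a^k\<close> in \<open>Y^p\<close>; the case \<open>m = 0\<close> is separate because \<open>m - 1\<close> truncates.
\<close>

definition ballot_coeff :: "nat \<Rightarrow> nat \<Rightarrow> nat \<Rightarrow> int" where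
  "ballot_coeff p m k = (if m = 0 then (if k = 0 then 1 else 0)
     else int (m + p - 1 choose k) * int (m choose k) - int (m + p choose k) * int (m - 1 choose k))"

text \<open>This is \<open>Y^(p+1) (1 + z - z a) = z Y^(p+2) + Y^p\<close> at
  \<open>z^(m+1) a^k\<close>; it follows from Pascal's rule.\<close>

lemma ballot_coeff_rec:
  "ballot_coeff (Suc p) (Suc m) k = ballot_coeff p (Suc m) k + ballot_coeff (Suc (Suc p)) m k
    - ballot_coeff (Suc p) m k + (if k = 0 then 0 else ballot_coeff (Suc p) m (k - 1))"
proof (cases m)
  case 0
  then show ?thesis
    by (cases k; cases "k - 1") (auto simp: ballot_coeff_def)
next
  case (Suc m')
  show ?thesis
  proof (cases k)
    case (Suc l)
    then show ?thesis
      by (cases l) (simp_all add: ballot_coeff_def \<open>m = Suc m'\<close> algebra_simps)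
  qed (simp add: ballot_coeff_def Suc)
qed

text \<open>Thus \<open>B\<close> is the coefficient of \<open>z^(n-i) a^k\<close> in
  \<open>Y^(i+j+1)\<close>.\<close>

lemma B_conv_ballot_coeff:
  assumes "i \<le> n"
  shows "B (int n + 1) (int k + 1) (int i) (int j) = ballot_coeff (Suc (i + j)) (n - i) k"
proof -
  have ib: "ibinomial (int u) (int k) = int (u choose k)" for u
    by (simp add: ibinomial_def)
  obtain m where n: "n = i + m"
    using assms le_Suc_ex by blast
  have *: "int (Suc u) - 1 = int u" "int n + 1 - int i - 1 = int m"
    "int n + 1 + int j = int (Suc (m + i + j))" "int k + 1 - 1 = int k" for u
    by (simp_all add: n)
  show ?thesis
  proof (cases m)
    case 0
    have "int n + 1 - int i - 2 = - 1"
      by (simp add: n 0)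
    \<comment> \<open>The convention \<open>ibinomial (-1) 0 = 0\<close> matches the separate case
      \<open>m = 0\<close> of \<open>ballot_coeff\<close>.\<close>
    moreover have "ibinomial (- 1) (int k) = 0"
      by (simp add: ibinomial_def)
    ultimately show ?thesis
      unfolding B_def * ib by (simp add: n 0 ballot_coeff_def)
  next
    case (Suc m')
    have "int n + 1 - int i - 2 = int m'"
      by (simp add: n Suc)
    then show ?thesis
      unfolding B_def * ib by (simp add: n Suc ballot_coeff_def ib add_ac)
  qed
qed

text \<open>This is \<open>Y^p\<close>, with \<open>z\<close> as the outer variable
  \<open>fps_X\<close> and \<open>a\<close> as the inner one, embedded as
  \<open>fps_const fps_X\<close>.\<close>

definition ballot_series :: "nat \<Rightarrow> int poly fps fps" where
  "ballot_series p = Abs_fps (\<lambda>m. Abs_fps (\<lambda>k. of_int (ballot_coeff p m k)))"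

lemma ballot_series_kernel:
  "ballot_series (Suc p) * (1 + fps_X - fps_X * fps_const fps_X) =
    fps_X * ballot_series (Suc (Suc p)) + ballot_series p"
proof -
  have *: "G * (1 + fps_X - fps_X * fps_const a) = G + fps_X * G - fps_X * (fps_const a * G)"
    for G :: "int poly fps fps" and a
    by (simp add: algebra_simps)
  show ?thesis
    unfolding * fps_eq_iff
  proof (intro allI)
    fix m k
    show "(ballot_series (Suc p) + fps_X * ballot_series (Suc p)
        - fps_X * (fps_const fps_X * ballot_series (Suc p))) $ m $ k
      = (fps_X * ballot_series (Suc (Suc p)) + ballot_series p) $ m $ k"
    proof (cases m)
      case 0
      then show ?thesis
        by (simp add: ballot_series_def ballot_coeff_def)
    next
      case (Suc m')
      then show ?thesis
        by (simp add: ballot_series_def ballot_coeff_rec)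
    qed
  qed
qed

abbreviation qconst :: "int poly \<Rightarrow> int poly fps fps" where
  "qconst x \<equiv> fps_const (fps_const x)"

text \<open>The finite q-binomial theorem for \<open>(Y;q)\<^sub>i\<close>, by induction with the
  q-Pascal rule.\<close>

lemma qpoch_mult_conv_qbinomial:
  "qpoch_mult (qconst qvar) Y i p =
    (\<Sum>j\<le>i. qconst ((- 1) ^ j * qvar ^ (j choose 2) * qbinomial i j) * Y (p + j))"
proof (induction i arbitrary: p)
  case 0
  then show ?case
    by (simp add: qbinomial_0 binomial_eq_0)
next
  case (Suc i)
  define e where "e i j = (- 1) ^ j * qvar ^ (j choose 2) * qbinomial i j" for i j
  have e0: "e i 0 = 1" for i
    by (simp add: e_def qbinomial_0 binomial_eq_0)
  \<comment> \<open>The exponents combine as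
    \<open>(j + 1 choose 2) + (i - j) = (j choose 2) + i\<close>.\<close>
  have eS: "e (Suc i) (Suc j) = e i (Suc j) - qvar ^ i * e i j" if "j \<le> i" for j
  proof -
    have "qvar ^ i = qvar ^ j * qvar ^ (i - j)"
      using that by (simp flip: power_add)
    moreover have "Suc j choose 2 = (j choose 2) + j"
      by (simp add: numeral_2_eq_2)
    ultimately show ?thesis
      unfolding e_def qbinomial_Suc_Suc[OF that] by (simp add: power_add algebra_simps)
  qed
  have top: "e i (Suc i) = 0"
    by (simp add: e_def qbinomial_def)
  have "(\<Sum>j\<le>Suc i. qconst (e (Suc i) j) * Y (p + j)) =
      Y p + (\<Sum>j\<le>i. qconst (e (Suc i) (Suc j)) * Y (p + Suc j))"
    by (simp only: sum.atMost_Suc_shift e0) simp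
  also have "(\<Sum>j\<le>i. qconst (e (Suc i) (Suc j)) * Y (p + Suc j)) =
      (\<Sum>j\<le>i. qconst (e i (Suc j)) * Y (p + Suc j))
      - qconst qvar ^ i * (\<Sum>j\<le>i. qconst (e i j) * Y (p + Suc j))"
    unfolding sum_distrib_left sum_subtractf[symmetric]
    by (rule sum.cong)
      (simp_all add: eS algebra_simps fps_const_power flip: fps_const_sub fps_const_mult)
  also have "Y p + ((\<Sum>j\<le>i. qconst (e i (Suc j)) * Y (p + Suc j))
      - qconst qvar ^ i * (\<Sum>j\<le>i. qconst (e i j) * Y (p + Suc j)))
      = (\<Sum>j\<le>Suc i. qconst (e i j) * Y (p + j))
      - qconst qvar ^ i * (\<Sum>j\<le>i. qconst (e i j) * Y (p + Suc j))"
    by (simp only: sum.atMost_Suc_shift[of _ i] e0) simp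
  also have "\<dots> = qpoch_mult (qconst qvar) Y (Suc i) p"
    by (simp add: top Suc flip: e_def)
  finally show ?case
    by (simp add: e_def)
qed

section \<open>Agreement of the series with the split generating functions\<close>

lemma height_series_nth_eq_0:
  fixes q :: "'a::comm_ring_1 fps"
  shows "n < c \<Longrightarrow> height_series q fps_X Y M c $ n = 0"
  unfolding height_series_def fps_sum_nth
  by (intro sum.neutral ballI) (simp add: mult.assoc mult.left_commute[of _ "fps_X ^ _"] fps_X_power_mult_nth)

text \<open>The differenced recurrence is summed back from \<open>c\<close> to \<open>n + 1\<close>.
  Since \<open>Suc n < M\<close>, the truncation error does not reach
  \<open>z^(n+1)\<close>.\<close>

lemma height_series_nth_Suc:
  fixes M :: nat
  defines "F \<equiv> height_series (qconst qvar) fps_X ballot_series M"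
  assumes "Suc n < M" "c \<le> Suc n"
  shows "F c $ Suc n = (1 - fps_const qvar ^ c) * F (c - 1) $ n + fps_X * (\<Sum>c'=c..n. F c' $ n)"
  using assms(3)
proof -
  define u where "u c = (1 - fps_const qvar ^ c) * F (c - 1) $ n" for c
  \<comment> \<open>\<open>F c\<close> is divisible by \<open>z^c\<close>; this gives the boundary
    values for the downward induction on \<open>c\<close>.\<close>
  have Z: "F (Suc n) $ n = 0" "F (Suc (Suc n)) $ Suc n = 0"
    by (simp_all add: F_def height_series_nth_eq_0)
  \<comment> \<open>For \<open>c = 0\<close> the form is the same: \<open>u 0 = 0\<close>, and
    \<open>Y 0 = 1\<close> has no coefficient at \<open>z^(n+1)\<close>.\<close>
  have D: "F c $ Suc n - F (Suc c) $ Suc n = u c - u (Suc c) + fps_X * F c $ n" for c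
  proof (cases c)
    case 0
    have "ballot_series 0 $ Suc n = 0"
      by (simp add: ballot_series_def ballot_coeff_def fps_eq_iff)
    then show ?thesis
      using arg_cong[where f = "\<lambda>G. G $ Suc n", OF height_series_rec_0[where Y = ballot_series and
          z = fps_X and a = "fps_const fps_X" and q = "qconst qvar" and M = M,
          OF ballot_series_kernel, folded F_def]] assms(2)
      by (simp add: u_def 0 mult.assoc fps_X_power_mult_nth left_diff_distrib)
  next
    case (Suc d)
    then show ?thesis
      using arg_cong[where f = "\<lambda>G. G $ Suc n", OF height_series_rec_Suc[where Y = ballot_series and
          z = fps_X and a = "fps_const fps_X" and q = "qconst qvar" and M = M and c = d,
          OF ballot_series_kernel, folded F_def]] assms(2)
      by (simp add: u_def mult.assoc fps_X_power_mult_nth left_diff_distrib fps_const_power)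
  qed
  from assms(3) have "F c $ Suc n = u c + fps_X * (\<Sum>c'=c..n. F c' $ n)"
  proof (induction rule: inc_induct)
    case base
    then show ?case
      using D[of "Suc n"] by (simp add: Z u_def)
  next
    case (step c)
    then have "(\<Sum>c'=c..n. F c' $ n) = F c $ n + (\<Sum>c'=Suc c..n. F c' $ n)"
      by (simp add: sum.atLeast_Suc_atMost)
    then show ?case
      using D[of c] step.IH by (simp add: algebra_simps)
  qed
  then show ?thesis
    by (simp add: u_def)
qed

text \<open>Both sides satisfy the same recurrence in \<open>n\<close>, because
  \<open>1 - q^c = (1 - q) [c]\<close>.\<close>

lemma height_series_nth:
  assumes "n < M" "c \<le> n"
  shows "height_series (qconst qvar) fps_X ballot_series M c $ n $ k
    = (1 - qvar) ^ (n - k) * split_S1 n k c"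
  using assms
proof (induction n arbitrary: c k)
  case 0
  have "height_series (qconst qvar) fps_X ballot_series M 0 $ 0 = ballot_series 0 $ 0"
    using arg_cong[where f = "\<lambda>G. G $ 0", OF height_series_rec_0[where Y = ballot_series and
        z = fps_X and a = "fps_const fps_X" and q = "qconst qvar" and M = M, OF ballot_series_kernel]] 0
      height_series_nth_eq_0[of 0 1 "qconst qvar" ballot_series M]
    by (simp add: mult.assoc)
  moreover have "ballot_series 0 $ 0 $ k = (if k = 0 then 1 else 0)"
    by (simp add: ballot_series_def ballot_coeff_def)
  ultimately show ?case
    using 0 by (simp add: split_S1_0)
next
  case (Suc n)
  define F where "F = height_series (qconst qvar) fps_X ballot_series M"
  have IH: "F c $ n $ k = (1 - qvar) ^ (n - k) * split_S1 n k c" if "c \<le> n" for c k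
    using Suc that by (simp add: F_def)
  have "F c $ Suc n $ k = (1 - qvar ^ c) * F (c - 1) $ n $ k
      + (if k = 0 then 0 else \<Sum>c'=c..n. F c' $ n $ (k - 1))"
    using height_series_nth_Suc[of n M c] Suc.prems
    by (simp add: F_def fps_sum_nth fps_const_power left_diff_distrib)
  also have "\<dots> = (1 - qvar ^ c) * ((1 - qvar) ^ (n - k) * split_S1 n k (c - 1))
      + (if k = 0 then 0 else \<Sum>c'=c..n. (1 - qvar) ^ (Suc n - k) * split_S1 n (k - 1) c')"
    using IH Suc.prems by (cases k) simp_all
  also have "(1 - qvar ^ c) * ((1 - qvar) ^ (n - k) * split_S1 n k (c - 1))
      = (1 - qvar) ^ (Suc n - k) * (qint c * split_S1 n k (c - 1))"
  proof (cases "k \<le> n")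
    case True
    then show ?thesis
      by (simp add: Suc_diff_le one_diff_power_eq qint_def)
  qed (simp add: split_S1_eq_0)
  also have "(1 - qvar) ^ (Suc n - k) * (qint c * split_S1 n k (c - 1))
      + (if k = 0 then 0 else \<Sum>c'=c..n. (1 - qvar) ^ (Suc n - k) * split_S1 n (k - 1) c')
      = (1 - qvar) ^ (Suc n - k) * split_S1 (Suc n) k c"
    using Suc.prems by (simp add: split_S1_Suc distrib_left sum_distrib_left)
  finally show ?case
    by (simp add: F_def)
qed

text \<open>The coefficient of \<open>z^n a^k\<close> in \<open>F\<^sub>0\<close> is expanded; the
  truncation \<open>M = n + 1\<close> keeps all terms that reach \<open>z^n\<close>.\<close>

lemma split_S1_formula:
  assumes "k \<le> n"
  shows "(1 - qvar) ^ (n - k) * split_S1 n k 0 =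
    (\<Sum>j=0..n - k. \<Sum>i=j..n - k.
      (-1) ^ j * of_int (B (int n + 1) (int k + 1) (int i) (int j))
        * qvar ^ (i + (j choose 2)) * qbinomial i j)"
proof -
  define t where "t i j = (-1) ^ j * of_int (B (int n + 1) (int k + 1) (int i) (int j))
        * qvar ^ (i + (j choose 2)) * qbinomial i j" for i j
  have q: "qconst qvar ^ i = qconst (qvar ^ i)" for i
    by (simp add: fps_const_power)
  have "(1 - qvar) ^ (n - k) * split_S1 n k 0 =
      height_series (qconst qvar) fps_X ballot_series (Suc n) 0 $ n $ k"
    by (simp add: height_series_nth)
  also have "\<dots> = (\<Sum>i<Suc n. \<Sum>j\<le>i. t i j)"
    unfolding height_series_def fps_sum_nth
  proof (rule sum.cong[OF refl])
    fix i assume "i \<in> {..<Suc n}"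
    then have i: "i \<le> n" by simp
    have "(qconst qvar ^ i * qpoch (qconst qvar) 0 i * fps_X ^ (0 + i)
        * qpoch_mult (qconst qvar) ballot_series i (Suc (0 + i))) $ n $ k
      = (fps_X ^ i * (qconst (qvar ^ i) * qpoch_mult (qconst qvar) ballot_series i (Suc i))) $ n $ k"
      by (simp add: q qpoch_def mult_ac)
    also have "\<dots> = qvar ^ i * qpoch_mult (qconst qvar) ballot_series i (Suc i) $ (n - i) $ k"
      using i by (simp add: fps_X_power_mult_nth)
    also have "\<dots> = (\<Sum>j\<le>i. t i j)"
      unfolding qpoch_mult_conv_qbinomial fps_sum_nth sum_distrib_left
      using i
      by (intro sum.cong)
        (simp_all add: t_def B_conv_ballot_coeff ballot_series_def power_add mult_ac)
    finally show "(qconst qvar ^ i * qpoch (qconst qvar) 0 i * fps_X ^ (0 + i)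
        * qpoch_mult (qconst qvar) ballot_series i (Suc (0 + i))) $ n $ k = (\<Sum>j\<le>i. t i j)" .
  qed
  also have "\<dots> = (\<Sum>i\<le>n - k. \<Sum>j\<le>i. t i j)"
  proof (rule sum.mono_neutral_right)
    \<comment> \<open>For \<open>i > n - k\<close> both products in \<open>B\<close> contain a
      binomial coefficient with upper entry below \<open>k\<close>.\<close>
    show "\<forall>i\<in>{..<Suc n} - {..n - k}. (\<Sum>j\<le>i. t i j) = 0"
    proof
      fix i assume "i \<in> {..<Suc n} - {..n - k}"
      then have "i \<le> n" "n - i < k" "n - i - 1 < k" "k > 0"
        using assms by auto
      then show "(\<Sum>j\<le>i. t i j) = 0"
        by (intro sum.neutral) (simp add: t_def B_conv_ballot_coeff ballot_coeff_def binomial_eq_0)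
    qed
  qed auto
  also have "\<dots> = (\<Sum>j\<le>n - k. \<Sum>i\<in>{i\<in>{..n - k}. j \<le> i}. t i j)"
    by (subst sum.swap_restrict[symmetric]) (auto intro!: sum.cong)
  also have "\<dots> = (\<Sum>j=0..n - k. \<Sum>i=j..n - k. t i j)"
    by (intro sum.cong) auto
  finally show ?thesis
    by (simp add: t_def)
qed

theorem theorem5p6:
  fixes n k :: nat
  assumes "k \<le> n"
  shows "(1 - qvar) ^ (n - k) * S1 n k =
    (\<Sum>j=0..n - k. \<Sum>i=j..n - k.
      (-1) ^ j * of_int (B (int n + 1) (int k + 1) (int i) (int j))
        * qvar ^ (i + (j choose 2)) * qbinomial i j)"
  using split_S1_formula[OF assms] by (simp add: S1_conv_split_S1)

end
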